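(* Suppose the two-phase constraint-adding algorithm described in the context terminates, with final MILP-phase iterate $(y^k,\bar x^k,\bar v^k,\bar w^k)$. Then this point, which is the solution of the coarse MILP with the added constraints, is an optimal solution of the semi-coarse MILP.
   Context: All vector inequalities are componentwise. Original data. Let $m,N,M$ be positive integers, $a\in\mathbb{R}^m$, $b,c,d\in\mathbb{R}^N$, $f\in\mathbb{R}^M$, $A\in\mathbb{R}^{M\times m}$, $B,C,D\in\mathbb{R}^{M\times N}$, and let $L\le U$ be finite real bounds. Let $\delta$ be a positive integer with $N=n\delta$, and suppose the $M$ constraint rows are partitioned into $n$ consecutive groups of size $\delta$ (so $M=n\delta$). Vectors in $\mathbb{R}^N$ are split into $n$ consecutive blocks of length $\delta$ (e.g. $b=(b_1,\dots,b_n)$), and $B=[B_1:\cdots:B_n]$, $C=[C_1:\cdots:C_n]$, $D=[D_1:\cdots:D_n]$ with $B_i,C_i,D_i\in\mathbb{R}^{M\times\delta}$. Profiles. Fixed data: $\bar X_k\in\{0,1\}^\delta$ for $k=1,\dots,K$; for each $k$, vectors $\bar V_{jk}\in\mathbb{R}^\delta$ with $L\bar X_k\le\bar V_{jk}\le U\bar X_k$ for $j=1,\dots,I_k$; and vectors $\bar W_j\in\mathbb{R}^\delta$ with $\bar W_j\ge0$ for $j=1,\dots,J$. Let $\bar X$, $\bar V$, $\bar W$ be the matrices whose columns are, respectively, all $\bar X_k$, all $\bar V_{jk}$ (ordered by $k$, then $j$), and all $\bar W_j$. Aggregated data. $\bar B=[B_1\bar X:\cdots:B_n\bar X]$, $\bar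 C=[C_1\bar V:\cdots:C_n\bar V]$, $\bar D=[D_1\bar W:\cdots:D_n\bar W]$, and $\bar b=[b_1^T\bar X:\cdots:b_n^T\bar X]^T$, $\bar c=[c_1^T\bar V:\cdots:c_n^T\bar V]^T$, $\bar d=[d_1^T\bar W:\cdots:d_n^T\bar W]^T$. The coefficient vectors $\bar x=(\bar x_{ik})$, $\bar v=(\bar v_{ijk})$, $\bar w=(\bar w_{ij})$ are ordered compatibly. Semi-coarse MILP: minimize $a^Ty+\bar b^T\bar x+\bar c^T\bar v+\bar d^T\bar w$ over $(y,\bar x,\bar v,\bar w)$ subject to the $M$ row constraints $Ay+\bar B\bar x+\bar C\bar v+\bar D\bar w\le f$, $y\in\{0,1\}^m$, and for all $i=1,\dots,n$: $\sum_{k=1}^K\bar x_{ik}\le1$, $\bar x_{ik}\in\{0,1\}$; $\sum_{k=1}^K\sum_{j=1}^{I_k}\bar v_{ijk}\le1$, $\sum_{j=1}^{I_k}\bar v_{ijk}=\bar x_{ik}$ for every $k$, $0\le\bar v_{ijk}\le1$; $\sum_{j=1}^J\bar w_{ij}\le1$, $0\le\bar w_{ij}\le1$. Coarse MILP: the same problem, except that the $M$ row constraints are replaced by the $n$ aggregated constraints $\hat Ay+\hat{\bar B}\bar x+\hat{\bar C}\bar v+\hat{\bar D}\bar w\le\hat f$, where a hat denotes summing the rows in each of the $n$ groups: the $g$-th row of $\hat A$ is $\sum_{i=1}^\delta A_{\delta(g-1)+i}^T$ (with $A_r^T$ the $r$-th row of $A$), and likewise for $\hat{\bar B},\hat{\bar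 C},\hat{\bar D},\hat f$. LP-relaxations replace $y\in\{0,1\}^m$ by $y\in[0,1]^m$ and $\bar x_{ik}\in\{0,1\}$ by $\bar x_{ik}\in[0,1]$. Algorithm. "Solve" means compute an optimal solution. LP warm-start phase: solve the LP-relaxation of the coarse MILP. While the current solution is infeasible for the LP-relaxation of the semi-coarse MILP, find the row constraints of the semi-coarse MILP violated by it, add them to the coarse MILP, and solve the LP-relaxation of the coarse MILP with all constraints added so far. MILP phase: set $k=0$ and solve the coarse MILP together with all constraints added in the LP phase, obtaining $(y^0,\bar x^0,\bar v^0,\bar w^0)$. While $(y^k,\bar x^k,\bar v^k,\bar w^k)$ is infeasible for the semi-coarse MILP, find the row constraints of the semi-coarse MILP violated by it, add them, solve the coarse MILP with all constraints added so far to obtain $(y^{k+1},\bar x^{k+1},\bar v^{k+1},\bar w^{k+1})$, and set $k\leftarrow k+1$. The algorithm terminates when the MILP-phase loop ends. *)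

theory Defs
  imports "Jordan_Normal_Form.Matrix"
begin

text \<open>
  All indices are shifted to start at 0: rows are \<open>0..<M\<close>, blocks and row groups \<open>0..<n\<close>,
  profiles \<open>0..<K\<close>, and so on. The order \<open>\<le>\<close> on \<open>real vec\<close> is the componentwise
  one, which also requires equal dimensions.
\<close>

record milp_data =
  dim_m :: nat
  dim_N :: nat
  dim_M :: nat
  num_blocks :: nat                          (* n *)
  block_size :: nat                          (* delta *)
  cost_a :: "real vec"
  cost_b :: "real vec"
  cost_c :: "real vec"
  cost_d :: "real vec"
  rhs_f :: "real vec"
  mat_A :: "real mat"
  mat_B :: "real mat"
  mat_C :: "real mat"
  mat_D :: "real mat"
  lower :: real                              (* L *)
  upper :: real                              (* U *)
  num_X :: nat                               (* K *)
  num_V :: "nat \<Rightarrow> nat"               (* I_k *)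
  num_W :: nat                               (* J *)
  prof_X :: "nat \<Rightarrow> real vec"
  prof_V :: "nat \<Rightarrow> nat \<Rightarrow> real vec"   (* arguments in the order j, k *)
  prof_W :: "nat \<Rightarrow> real vec"

definition valid_data :: "milp_data \<Rightarrow> bool" where
  "valid_data P \<longleftrightarrow>
     0 < dim_m P \<and> 0 < dim_N P \<and> 0 < dim_M P \<and> 0 < block_size P \<and>
     dim_N P = num_blocks P * block_size P \<and>
     dim_M P = num_blocks P * block_size P \<and>
     cost_a P \<in> carrier_vec (dim_m P) \<and>
     cost_b P \<in> carrier_vec (dim_N P) \<and>
     cost_c P \<in> carrier_vec (dim_N P) \<and>
     cost_d P \<in> carrier_vec (dim_N P) \<and>
     rhs_f P \<in> carrier_vec (dim_M P) \<and>
     mat_A P \<in> carrier_mat (dim_M P) (dim_m P) \<and>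
     mat_B P \<in> carrier_mat (dim_M P) (dim_N P) \<and>
     mat_C P \<in> carrier_mat (dim_M P) (dim_N P) \<and>
     mat_D P \<in> carrier_mat (dim_M P) (dim_N P) \<and>
     lower P \<le> upper P \<and>
     (\<forall>k<num_X P. prof_X P k \<in> carrier_vec (block_size P) \<and>
        (\<forall>t<block_size P. prof_X P k $ t \<in> {0, 1})) \<and>
     (\<forall>k<num_X P. \<forall>j<num_V P k. prof_V P j k \<in> carrier_vec (block_size P) \<and>
        lower P \<cdot>\<^sub>v prof_X P k \<le> prof_V P j k \<and>
        prof_V P j k \<le> upper P \<cdot>\<^sub>v prof_X P k) \<and>
     (\<forall>j<num_W P. prof_W P j \<in> carrier_vec (block_size P) \<and>
        0\<^sub>v (block_size P) \<le> prof_W P j)"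


subsection \<open>Profile matrices and aggregated data\<close>

definition X_bar :: "milp_data \<Rightarrow> real mat" where
  "X_bar P = mat_of_cols (block_size P) (map (prof_X P) [0..<num_X P])"

definition V_bar :: "milp_data \<Rightarrow> real mat" where
  "V_bar P = mat_of_cols (block_size P)
     (concat (map (\<lambda>k. map (\<lambda>j. prof_V P j k) [0..<num_V P k]) [0..<num_X P]))"

definition W_bar :: "milp_data \<Rightarrow> real mat" where
  "W_bar P = mat_of_cols (block_size P) (map (prof_W P) [0..<num_W P])"

definition col_block :: "nat \<Rightarrow> nat \<Rightarrow> real mat \<Rightarrow> real mat" where
  "col_block \<delta> i B = mat (dim_row B) \<delta> (\<lambda>(r, t). B $$ (r, i * \<delta> + t))"

definition vec_block :: "nat \<Rightarrow> nat \<Rightarrow> real vec \<Rightarrow> real vec" where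
  "vec_block \<delta> i b = vec \<delta> (\<lambda>t. b $ (i * \<delta> + t))"

text \<open>\<open>[B\<^sub>1 X : \<dots> : B\<^sub>n X]\<close> and \<open>[b\<^sub>1\<^sup>T X : \<dots> : b\<^sub>n\<^sup>T X]\<^sup>T\<close>\<close>

definition aggregate_mat :: "nat \<Rightarrow> nat \<Rightarrow> real mat \<Rightarrow> real mat \<Rightarrow> real mat" where
  "aggregate_mat n \<delta> B X =
     mat_of_cols (dim_row B) (concat (map (\<lambda>i. cols (col_block \<delta> i B * X)) [0..<n]))"

definition aggregate_vec :: "nat \<Rightarrow> nat \<Rightarrow> real vec \<Rightarrow> real mat \<Rightarrow> real vec" where
  "aggregate_vec n \<delta> b X =
     vec_of_list (concat (map (\<lambda>i. list_of_vec (transpose_mat X *\<^sub>v vec_block \<delta> i b)) [0..<n]))"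

definition B_bar :: "milp_data \<Rightarrow> real mat" where
  "B_bar P = aggregate_mat (num_blocks P) (block_size P) (mat_B P) (X_bar P)"

definition C_bar :: "milp_data \<Rightarrow> real mat" where
  "C_bar P = aggregate_mat (num_blocks P) (block_size P) (mat_C P) (V_bar P)"

definition D_bar :: "milp_data \<Rightarrow> real mat" where
  "D_bar P = aggregate_mat (num_blocks P) (block_size P) (mat_D P) (W_bar P)"

definition b_bar :: "milp_data \<Rightarrow> real vec" where
  "b_bar P = aggregate_vec (num_blocks P) (block_size P) (cost_b P) (X_bar P)"

definition c_bar :: "milp_data \<Rightarrow> real vec" where
  "c_bar P = aggregate_vec (num_blocks P) (block_size P) (cost_c P) (V_bar P)"

definition d_bar :: "milp_data \<Rightarrow> real vec" where
  "d_bar P = aggregate_vec (num_blocks P) (block_size P) (cost_d P) (W_bar P)"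

text \<open>The hat: summing the rows in each of the \<open>n\<close> consecutive groups of size \<open>\<delta>\<close>.\<close>

definition hat_mat :: "nat \<Rightarrow> nat \<Rightarrow> real mat \<Rightarrow> real mat" where
  "hat_mat n \<delta> A = mat n (dim_col A) (\<lambda>(g, j). \<Sum>i<\<delta>. A $$ (g * \<delta> + i, j))"

definition hat_vec :: "nat \<Rightarrow> nat \<Rightarrow> real vec \<Rightarrow> real vec" where
  "hat_vec n \<delta> f = vec n (\<lambda>g. \<Sum>i<\<delta>. f $ (g * \<delta> + i))"


subsection \<open>The optimization problems\<close>

text \<open>
  A point is \<open>(y, x, v, w)\<close> with flattened coefficient vectors; the three index functions
  locate \<open>x\<^sub>i\<^sub>k\<close>, \<open>v\<^sub>i\<^sub>j\<^sub>k\<close> and \<open>w\<^sub>i\<^sub>j\<close> in the column order of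
  \<open>B_bar\<close>, \<open>C_bar\<close> and \<open>D_bar\<close>.
\<close>

type_synonym point = "real vec \<times> real vec \<times> real vec \<times> real vec"

definition total_V :: "milp_data \<Rightarrow> nat" where
  "total_V P = (\<Sum>k<num_X P. num_V P k)"

definition x_idx :: "milp_data \<Rightarrow> nat \<Rightarrow> nat \<Rightarrow> nat" where
  "x_idx P i k = i * num_X P + k"

definition v_idx :: "milp_data \<Rightarrow> nat \<Rightarrow> nat \<Rightarrow> nat \<Rightarrow> nat" where
  "v_idx P i j k = i * total_V P + (\<Sum>k'<k. num_V P k') + j"

definition w_idx :: "milp_data \<Rightarrow> nat \<Rightarrow> nat \<Rightarrow> nat" where
  "w_idx P i j = i * num_W P + j"

fun objective :: "milp_data \<Rightarrow> point \<Rightarrow> real" where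
  "objective P (y, x, v, w) =
     cost_a P \<bullet> y + b_bar P \<bullet> x + c_bar P \<bullet> v + d_bar P \<bullet> w"

text \<open>
  The constraints other than the row constraints. The entries of \<open>y\<close> and \<open>x\<close> range over
  \<open>S\<close>, which is \<open>{0, 1}\<close> for the MILPs and \<open>{0..1}\<close> for their LP-relaxations.
\<close>

fun block_constraints :: "milp_data \<Rightarrow> real set \<Rightarrow> point \<Rightarrow> bool" where
  "block_constraints P S (y, x, v, w) \<longleftrightarrow>
     y \<in> carrier_vec (dim_m P) \<and>
     x \<in> carrier_vec (num_blocks P * num_X P) \<and>
     v \<in> carrier_vec (num_blocks P * total_V P) \<and>
     w \<in> carrier_vec (num_blocks P * num_W P) \<and>
     (\<forall>l<dim_m P. y $ l \<in> S) \<and>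
     (\<forall>i<num_blocks P.
        (\<Sum>k<num_X P. x $ x_idx P i k) \<le> 1 \<and>
        (\<forall>k<num_X P. x $ x_idx P i k \<in> S) \<and>
        (\<Sum>k<num_X P. \<Sum>j<num_V P k. v $ v_idx P i j k) \<le> 1 \<and>
        (\<forall>k<num_X P. (\<Sum>j<num_V P k. v $ v_idx P i j k) = x $ x_idx P i k) \<and>
        (\<forall>k<num_X P. \<forall>j<num_V P k. 0 \<le> v $ v_idx P i j k \<and> v $ v_idx P i j k \<le> 1) \<and>
        (\<Sum>j<num_W P. w $ w_idx P i j) \<le> 1 \<and>
        (\<forall>j<num_W P. 0 \<le> w $ w_idx P i j \<and> w $ w_idx P i j \<le> 1))"

fun row_lhs :: "milp_data \<Rightarrow> point \<Rightarrow> real vec" where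
  "row_lhs P (y, x, v, w) =
     mat_A P *\<^sub>v y + B_bar P *\<^sub>v x + C_bar P *\<^sub>v v + D_bar P *\<^sub>v w"

fun coarse_row_lhs :: "milp_data \<Rightarrow> point \<Rightarrow> real vec" where
  "coarse_row_lhs P (y, x, v, w) =
     hat_mat (num_blocks P) (block_size P) (mat_A P) *\<^sub>v y +
     hat_mat (num_blocks P) (block_size P) (B_bar P) *\<^sub>v x +
     hat_mat (num_blocks P) (block_size P) (C_bar P) *\<^sub>v v +
     hat_mat (num_blocks P) (block_size P) (D_bar P) *\<^sub>v w"

definition semi_coarse_feasible :: "milp_data \<Rightarrow> real set \<Rightarrow> point \<Rightarrow> bool" where
  "semi_coarse_feasible P S z \<longleftrightarrow> block_constraints P S z \<and> row_lhs P z \<le> rhs_f P"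

text \<open>The coarse problem together with the semi-coarse row constraints indexed by \<open>R\<close>.\<close>

definition coarse_feasible :: "milp_data \<Rightarrow> real set \<Rightarrow> nat set \<Rightarrow> point \<Rightarrow> bool" where
  "coarse_feasible P S R z \<longleftrightarrow>
     block_constraints P S z \<and>
     coarse_row_lhs P z \<le> hat_vec (num_blocks P) (block_size P) (rhs_f P) \<and>
     (\<forall>r\<in>R. row_lhs P z $ r \<le> rhs_f P $ r)"

definition semi_coarse_optimal :: "milp_data \<Rightarrow> real set \<Rightarrow> point \<Rightarrow> bool" where
  "semi_coarse_optimal P S z \<longleftrightarrow> is_arg_min (objective P) (semi_coarse_feasible P S) z"

definition coarse_optimal :: "milp_data \<Rightarrow> real set \<Rightarrow> nat set \<Rightarrow> point \<Rightarrow> bool" where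
  "coarse_optimal P S R z \<longleftrightarrow> is_arg_min (objective P) (coarse_feasible P S R) z"


subsection \<open>The algorithm\<close>

definition violated_rows :: "milp_data \<Rightarrow> point \<Rightarrow> nat set" where
  "violated_rows P z = {r. r < dim_M P \<and> \<not> row_lhs P z $ r \<le> rhs_f P $ r}"

text \<open>
  Since ``solve'' may return any optimal solution, the algorithm is a nondeterministic
  transition system. \<open>lp_phase P R z\<close>: the LP phase can reach a state in which the rows in
  \<open>R\<close> have been added and the current solution is \<open>z\<close>. \<open>milp_phase P k R z\<close>: likewise
  for the MILP phase, \<open>z\<close> being the iterate with index \<open>k\<close>; it is entered only once the
  loop of the LP phase has ended.
\<close>

inductive lp_phase :: "milp_data \<Rightarrow> nat set \<Rightarrow> point \<Rightarrow> bool" for P where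
  lp_init: "coarse_optimal P {0..1} {} z \<Longrightarrow> lp_phase P {} z"
| lp_step: "lp_phase P R z \<Longrightarrow> \<not> semi_coarse_feasible P {0..1} z \<Longrightarrow>
    R' = R \<union> violated_rows P z \<Longrightarrow> coarse_optimal P {0..1} R' z' \<Longrightarrow>
    lp_phase P R' z'"

inductive milp_phase :: "milp_data \<Rightarrow> nat \<Rightarrow> nat set \<Rightarrow> point \<Rightarrow> bool" for P where
  milp_init: "lp_phase P R z \<Longrightarrow> semi_coarse_feasible P {0..1} z \<Longrightarrow>
    coarse_optimal P {0, 1} R z' \<Longrightarrow> milp_phase P 0 R z'"
| milp_step: "milp_phase P k R z \<Longrightarrow> \<not> semi_coarse_feasible P {0, 1} z \<Longrightarrow>
    R' = R \<union> violated_rows P z \<Longrightarrow> coarse_optimal P {0, 1} R' z' \<Longrightarrow>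
    milp_phase P (Suc k) R' z'"

definition terminates_with :: "milp_data \<Rightarrow> nat \<Rightarrow> nat set \<Rightarrow> point \<Rightarrow> bool" where
  "terminates_with P k R z \<longleftrightarrow> milp_phase P k R z \<and> semi_coarse_feasible P {0, 1} z"

end

theory Submission
  imports Defs
begin

text \<open>
  Each coarse row constraint is a sum of semi-coarse row constraints, and each constraint added
  by the algorithm is one of the semi-coarse row constraints. Hence, whatever rows have been
  added, the problem solved in the MILP phase is a relaxation of the semi-coarse MILP with the
  same objective (\<open>coarse_feasible_if_semi_coarse_feasible\<close>). The loop ends exactly when the
  minimizer of such a relaxation happens to be feasible for the semi-coarse MILP, and a minimizer
  over a larger set that lies in the smaller set is a minimizer over the smaller set
  (\<open>is_arg_min_restrict\<close>).

  That the hatted constraints are sums of the original ones is the linearity of row summation: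
  it commutes with multiplication by a matrix (\<open>hat_mat_mult_vec\<close>), with addition, and is
  monotone.
\<close>

lemma is_arg_min_restrict:
  assumes "is_arg_min f Q z" and "P z" and "\<And>u. P u \<Longrightarrow> Q u"
  shows "is_arg_min f P z"
  using assms unfolding is_arg_min_def by blast

lemma group_row_less:
  fixes g i n \<delta> :: nat
  assumes "g < n" and "i < \<delta>"
  shows "g * \<delta> + i < n * \<delta>"
proof -
  have "g * \<delta> + i < Suc g * \<delta>" using assms by simp
  also have "\<dots> \<le> n * \<delta>" using assms by (intro mult_le_mono1) simp
  finally show ?thesis .
qed

text \<open>
  Row summation is multiplication from the left by a zero-one matrix, so this is
  associativity; in coordinates it is an exchange of two finite sums.
\<close>

lemma hat_mat_mult_vec:
  assumes "dim_row A = n * \<delta>" and "dim_vec x = dim_col A"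
  shows "hat_mat n \<delta> A *\<^sub>v x = hat_vec n \<delta> (A *\<^sub>v x)"
proof (rule eq_vecI)
  fix g assume "g < dim_vec (hat_vec n \<delta> (A *\<^sub>v x))"
  then have g: "g < n" by (simp add: hat_vec_def)
  have "(hat_mat n \<delta> A *\<^sub>v x) $ g
      = (\<Sum>j<dim_col A. (\<Sum>i<\<delta>. A $$ (g * \<delta> + i, j)) * x $ j)"
    using g assms by (simp add: hat_mat_def scalar_prod_def lessThan_atLeast0)
  also have "\<dots> = (\<Sum>i<\<delta>. \<Sum>j<dim_col A. A $$ (g * \<delta> + i, j) * x $ j)"
    unfolding sum_distrib_right by (rule sum.swap)
  also have "\<dots> = hat_vec n \<delta> (A *\<^sub>v x) $ g"
    using g assms by (simp add: hat_vec_def scalar_prod_def lessThan_atLeast0 group_row_less)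
  finally show "(hat_mat n \<delta> A *\<^sub>v x) $ g = hat_vec n \<delta> (A *\<^sub>v x) $ g" .
qed (simp add: hat_mat_def hat_vec_def)

lemma hat_vec_add:
  assumes "dim_vec u = n * \<delta>"
  shows "hat_vec n \<delta> (t + u) = hat_vec n \<delta> t + hat_vec n \<delta> u"
  using assms by (intro eq_vecI) (auto simp: hat_vec_def group_row_less sum.distrib)

lemma hat_vec_mono:
  assumes "t \<le> u" and "dim_vec u = n * \<delta>"
  shows "hat_vec n \<delta> t \<le> hat_vec n \<delta> u"
  using assms by (auto simp: less_eq_vec_def hat_vec_def group_row_less intro!: sum_mono)

lemma dim_row_aggregate_mat: "dim_row (aggregate_mat n \<delta> B X) = dim_row B"
  by (simp add: aggregate_mat_def)

lemma dim_col_aggregate_mat: "dim_col (aggregate_mat n \<delta> B X) = n * dim_col X"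
  by (simp add: aggregate_mat_def length_concat comp_def sum_list_triv)

lemma dim_col_X_bar: "dim_col (X_bar P) = num_X P"
  by (simp add: X_bar_def)

lemma dim_col_V_bar: "dim_col (V_bar P) = total_V P"
  by (simp add: V_bar_def total_V_def length_concat comp_def
      interv_sum_list_conv_sum_set_nat lessThan_atLeast0)

lemma dim_col_W_bar: "dim_col (W_bar P) = num_W P"
  by (simp add: W_bar_def)

lemma coarse_row_lhs_eq_hat_row_lhs:
  assumes "valid_data P" and "block_constraints P S z"
  shows "coarse_row_lhs P z = hat_vec (num_blocks P) (block_size P) (row_lhs P z)"
proof (cases z)
  case (fields y x v w)
  have rows: "dim_row (mat_A P) = num_blocks P * block_size P"
    "dim_row (B_bar P) = num_blocks P * block_size P"
    "dim_row (C_bar P) = num_blocks P * block_size P"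
    "dim_row (D_bar P) = num_blocks P * block_size P"
    using assms(1)
    by (auto simp: valid_data_def B_bar_def C_bar_def D_bar_def dim_row_aggregate_mat)
  have cols: "dim_vec y = dim_col (mat_A P)" "dim_vec x = dim_col (B_bar P)"
    "dim_vec v = dim_col (C_bar P)" "dim_vec w = dim_col (D_bar P)"
    using assms unfolding fields
    by (auto simp: valid_data_def B_bar_def C_bar_def D_bar_def dim_col_aggregate_mat
        dim_col_X_bar dim_col_V_bar dim_col_W_bar)
  show ?thesis
    unfolding fields using rows cols by (simp add: hat_vec_add hat_mat_mult_vec)
qed

text \<open>
  Adding semi-coarse rows to the coarse problem never removes a semi-coarse feasible point. The
  bound on \<open>R\<close> matters because vector entries outside the dimension are unspecified.
\<close>

lemma coarse_feasible_if_semi_coarse_feasible: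
  assumes valid: "valid_data P" and R: "R \<subseteq> {..<dim_M P}"
    and feas: "semi_coarse_feasible P S z"
  shows "coarse_feasible P S R z"
proof -
  from feas have block: "block_constraints P S z" and rows: "row_lhs P z \<le> rhs_f P"
    by (auto simp: semi_coarse_feasible_def)
  from valid have dim: "dim_vec (rhs_f P) = dim_M P" "dim_M P = num_blocks P * block_size P"
    by (auto simp: valid_data_def)
  have "coarse_row_lhs P z \<le> hat_vec (num_blocks P) (block_size P) (rhs_f P)"
    unfolding coarse_row_lhs_eq_hat_row_lhs[OF valid block]
    using rows dim by (intro hat_vec_mono) simp_all
  moreover have "\<forall>r\<in>R. row_lhs P z $ r \<le> rhs_f P $ r"
    using rows R dim(1) by (auto simp: less_eq_vec_def)
  ultimately show ?thesis
    using block by (simp add: coarse_feasible_def)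
qed

lemma lp_phase_rows: "lp_phase P R z \<Longrightarrow> R \<subseteq> {..<dim_M P}"
  by (induction rule: lp_phase.induct) (auto simp: violated_rows_def)

lemma milp_phase_rows: "milp_phase P k R z \<Longrightarrow> R \<subseteq> {..<dim_M P}"
  by (induction rule: milp_phase.induct) (auto simp: violated_rows_def dest: lp_phase_rows)

lemma milp_phase_coarse_optimal: "milp_phase P k R z \<Longrightarrow> coarse_optimal P {0, 1} R z"
  by (induction rule: milp_phase.induct) auto

theorem proposition2p3:
  fixes P :: milp_data and k :: nat and R :: "nat set"
    and y x v w :: "real vec"
  assumes "valid_data P"
    and "terminates_with P k R (y, x, v, w)"
  shows "coarse_optimal P {0, 1} R (y, x, v, w) \<and> semi_coarse_optimal P {0, 1} (y, x, v, w)"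
proof -
  let ?z = "(y, x, v, w)"
  from assms(2) have run: "milp_phase P k R ?z" and feas: "semi_coarse_feasible P {0, 1} ?z"
    by (auto simp: terminates_with_def)
  have opt: "coarse_optimal P {0, 1} R ?z"
    using run by (rule milp_phase_coarse_optimal)
  have "is_arg_min (objective P) (semi_coarse_feasible P {0, 1}) ?z"
    using opt[unfolded coarse_optimal_def] feas
      coarse_feasible_if_semi_coarse_feasible[OF assms(1) milp_phase_rows[OF run]]
    by (rule is_arg_min_restrict)
  then show ?thesis
    using opt by (simp add: semi_coarse_optimal_def)
qed

end
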